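(* Let $\mathbf{H}\in\mathbb{R}^{3\times3}$ be symmetric positive definite, $\mathbf{b}\in\mathbb{R}^3$, and $f(\mathbf{x})=\frac12\mathbf{x}^T\mathbf{H}\mathbf{x}+\mathbf{b}^T\mathbf{x}$. For every starting point $\mathbf{x}_0\in\mathbb{R}^3$ and every integer cycle length $T\geq3$, the NY algorithm (described in the context) applied to $\min_{\mathbf{x}\in\mathbb{R}^3}f(\mathbf{x})$ terminates within $2T+1$ iterations, i.e. $\nabla f(\mathbf{x}_k)=\mathbf{0}$ for some $k\leq 2T+1$.
   Context: NY algorithm. Write $\mathbf{g}_k=\nabla f(\mathbf{x}_k)$; the norm is Euclidean. Starting from $\mathbf{x}_0$, the algorithm stops at iteration $k$ if $\mathbf{g}_k=\mathbf{0}$; otherwise $\mathbf{x}_{k+1}=\mathbf{x}_k-\alpha_k\mathbf{g}_k$ with $$\alpha_k=\begin{cases}\alpha_k^{SD},&\mathrm{mod}(k,T)<2,\\ \alpha_k^{NY},&\mathrm{mod}(k,T)=2,\\ \alpha_{k-1},&\text{otherwise},\end{cases}$$ where $\alpha_k^{SD}=\frac{\mathbf{g}_k^T\mathbf{g}_k}{\mathbf{g}_k^T\mathbf{H}\mathbf{g}_k}$ is the Cauchy stepsize, and $\alpha_k^{NY}$ is defined as follows (for $\mathrm{mod}(k,T)=2$, so that iterations $k-2$ and $k-1$ used Cauchy stepsizes). Put $$\beta=\frac{\|\mathbf{g}_k\|^2}{(\alpha_{k-1}^{SD})^2\|\mathbf{g}_{k-1}\|^2},\quad \gamma=\frac{(\mathbf{g}_k^T\mathbf{g}_{k-2})^2}{\|\mathbf{g}_{k-2}\|^2\|\mathbf{g}_k\|^2}.$$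 If $\mathbf{g}_{k-2}$ and $\mathbf{g}_k$ are not parallel, put $a_{11}=\frac{1}{\alpha_{k-2}^{SD}}$, $a_{22}=\frac{1}{\alpha_{k-1}^{SD}}$, $a_{33}=\frac{1/\alpha_k^{SD}-\gamma/\alpha_{k-2}^{SD}}{1-\gamma}$, $$t_1=a_{11}+a_{22}+a_{33},\quad t_2=a_{11}a_{22}+(a_{11}+a_{22})a_{33}-\beta,\quad t_3=a_{11}a_{22}a_{33}-a_{11}\beta(1-\gamma)-a_{33}\beta\gamma,$$ $p=t_2-\frac{t_1^2}{3}$, $q=-\frac{2t_1^3}{27}+\frac{t_1t_2}{3}-t_3$; then $$(\alpha_k^{NY})^{-1}=\frac{t_1}{3}+2\sqrt{-\frac p3}\cos\Big(\frac13\arccos\Big(\frac{3q}{2p}\sqrt{\frac{-3}{p}}\Big)\Big),$$ the largest root of $\mu^3-t_1\mu^2+t_2\mu-t_3=0$. If $\mathbf{g}_{k-2}$ and $\mathbf{g}_k$ are parallel, $(\alpha_k^{NY})^{-1}$ is the largest root of $(\mu-\frac{1}{\alpha_{k-2}^{SD}})(\mu-\frac{1}{\alpha_{k-1}^{SD}})-\beta=0$ (so that $\alpha_k^{NY}$ is Yuan's stepsize). *)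

theory Defs
  imports "HOL-Analysis.Analysis"
begin

definition gradient :: "('a::real_inner \<Rightarrow> real) \<Rightarrow> 'a \<Rightarrow> 'a" where
  "gradient f x = (THE D. GDERIV f x :> D)"

definition quadratic :: "real^'n^'n \<Rightarrow> real^'n \<Rightarrow> real^'n \<Rightarrow> real" where
  "quadratic H b x = 1 / 2 * (x \<bullet> (H *v x)) + b \<bullet> x"

text \<open>Cauchy (exact line search) stepsize at a point with gradient \<open>g\<close>.\<close>

definition sd_step :: "real^'n^'n \<Rightarrow> real^'n \<Rightarrow> real" where
  "sd_step H g = (g \<bullet> g) / (g \<bullet> (H *v g))"

text \<open>
  The arguments \<open>g\<^sub>0\<close>, \<open>g\<^sub>1\<close>, \<open>g\<^sub>2\<close> stand for the gradients at iterations \<open>k - 2\<close>, \<open>k - 1\<close>, \<open>k\<close>.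
  Two vectors are parallel iff they are collinear with the origin.
\<close>

definition ny_step :: "real^'n^'n \<Rightarrow> real^'n \<Rightarrow> real^'n \<Rightarrow> real^'n \<Rightarrow> real" where
  "ny_step H g\<^sub>0 g\<^sub>1 g\<^sub>2 =
    (let \<beta> = (norm g\<^sub>2)\<^sup>2 / ((sd_step H g\<^sub>1)\<^sup>2 * (norm g\<^sub>1)\<^sup>2);
         \<gamma> = (g\<^sub>2 \<bullet> g\<^sub>0)\<^sup>2 / ((norm g\<^sub>0)\<^sup>2 * (norm g\<^sub>2)\<^sup>2);
         a11 = 1 / sd_step H g\<^sub>0;
         a22 = 1 / sd_step H g\<^sub>1
     in inverse
       (if collinear {0, g\<^sub>0, g\<^sub>2}
        then (GREATEST \<mu>. (\<mu> - a11) * (\<mu> - a22) - \<beta> = 0)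
        else
          (let a33 = (1 / sd_step H g\<^sub>2 - \<gamma> / sd_step H g\<^sub>0) / (1 - \<gamma>);
               t1 = a11 + a22 + a33;
               t2 = a11 * a22 + (a11 + a22) * a33 - \<beta>;
               t3 = a11 * a22 * a33 - a11 * \<beta> * (1 - \<gamma>) - a33 * \<beta> * \<gamma>;
               p = t2 - t1\<^sup>2 / 3;
               q = - (2 * t1 ^ 3 / 27) + t1 * t2 / 3 - t3
           in t1 / 3 + 2 * sqrt (- p / 3) *
                cos (1 / 3 * arccos (3 * q / (2 * p) * sqrt (- 3 / p))))))"

text \<open>
  Iterates and stepsizes of the NY algorithm with cycle length \<open>T\<close>. Once the gradient
  vanishes, the algorithm has stopped; this is modelled by keeping the iterate constant
  from then on, and the stepsizes at such iterations have no meaning. The subtractions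
  on indices do not truncate in the branches where they occur.
\<close>

function ny_iterate :: "real^'n^'n \<Rightarrow> real^'n \<Rightarrow> nat \<Rightarrow> real^'n \<Rightarrow> nat \<Rightarrow> real^'n"
  and ny_alpha :: "real^'n^'n \<Rightarrow> real^'n \<Rightarrow> nat \<Rightarrow> real^'n \<Rightarrow> nat \<Rightarrow> real"
where
  "ny_iterate H b T x\<^sub>0 0 = x\<^sub>0"
| "ny_iterate H b T x\<^sub>0 (Suc k) =
     (let g = gradient (quadratic H b) (ny_iterate H b T x\<^sub>0 k)
      in if g = 0 then ny_iterate H b T x\<^sub>0 k
         else ny_iterate H b T x\<^sub>0 k - ny_alpha H b T x\<^sub>0 k *\<^sub>R g)"
| "ny_alpha H b T x\<^sub>0 k =
     (if k mod T < 2 then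
        sd_step H (gradient (quadratic H b) (ny_iterate H b T x\<^sub>0 k))
      else if k mod T = 2 then
        ny_step H (gradient (quadratic H b) (ny_iterate H b T x\<^sub>0 (k - 2)))
                  (gradient (quadratic H b) (ny_iterate H b T x\<^sub>0 (k - 1)))
                  (gradient (quadratic H b) (ny_iterate H b T x\<^sub>0 k))
      else ny_alpha H b T x\<^sub>0 (k - 1))"
  by pat_completeness auto
termination
  by (relation "Wellfounded.measure (\<lambda>s. case s of Inl (H, b, T, x, k) \<Rightarrow> 2 * k
                                      | Inr (H, b, T, x, k) \<Rightarrow> 2 * k + 1)")
     (auto intro!: diff_less Nat.gr0I)

declare ny_alpha.simps [simp del]

end

theory Submission
  imports Defs
begin

text \<open>
  Since \<open>g\<^sub>0 \<bottom> g\<^sub>1 \<bottom> g\<^sub>2\<close> after two Cauchy steps, \<open>H\<close> becomes tridiagonal in the orthogonal basis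
  \<open>g\<^sub>0, g\<^sub>1, w\<close>, where \<open>w\<close> is the part of \<open>g\<^sub>2\<close> orthogonal to \<open>g\<^sub>0\<close>, and the NY cubic is its
  characteristic polynomial. Because \<open>1 / \<alpha>\<close> is a root of it, the NY step splits off a linear factor,
  so the next gradient is annihilated by a quadratic polynomial in \<open>H\<close>, and so are all later ones.
  In the second cycle this makes \<open>g\<^sub>0\<close> and \<open>g\<^sub>2\<close> parallel, Yuan's step splits off another factor and
  leaves an eigenvector of \<open>H\<close>, and the next Cauchy step, at iteration \<open>2T\<close>, is exact.
\<close>

section \<open>Real roots of cubics and quadratics\<close>

text \<open>Viete's substitution \<open>s = 2 * m * cos \<theta>\<close> with
  \<open>p = - 3 * m\<^sup>2\<close> turns the cubic into the triple-angle identity. The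
  \<open>arccos\<close> argument must lie in [-1, 1], that is, the local maximum at
  \<open>- m\<close> must be nonnegative and the local minimum at \<open>m\<close> nonpositive; the
  drop in sign from \<open>x\<close> to \<open>y\<close> forces both.\<close>

lemma depressed_cubic_trig_root:
  fixes p q x y :: real
  assumes p: "p < 0" and "x < y" and fx: "x ^ 3 + p * x + q \<ge> 0" and fy: "y ^ 3 + p * y + q \<le> 0"
  defines "s \<equiv> 2 * sqrt (- p / 3) * cos (1 / 3 * arccos (3 * q / (2 * p) * sqrt (- 3 / p)))"
  shows "s ^ 3 + p * s + q = 0" and "s > 0"
proof -
  define m where "m = sqrt (- p / 3)"
  have m: "m > 0" and pm: "p = - 3 * m\<^sup>2"
    using p by (auto simp: m_def)
  have sqrt_eq: "sqrt (- 3 / p) = 1 / m"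
    using m by (intro real_sqrt_unique) (auto simp: pm field_simps power2_eq_square)
  have arg: "3 * q / (2 * p) * sqrt (- 3 / p) = - q / (2 * m ^ 3)"
    unfolding sqrt_eq unfolding pm by (simp add: power2_eq_square power3_eq_cube)
  have increasing: "u ^ 3 + p * u < v ^ 3 + p * v"
    if "u < v" and "m \<le> u \<or> v \<le> - m" for u v
  proof -
    have "v\<^sup>2 + u * v + u\<^sup>2 > 3 * m\<^sup>2"
      using that(2)
    proof
      assume "m \<le> u"
      with m \<open>u < v\<close> have "m * m \<le> u * u" "m * m \<le> u * v" "m * m < v * v"
        by (auto intro: mult_mono mult_strict_mono)
      then show ?thesis by (simp add: power2_eq_square)
    next
      assume "v \<le> - m"
      with m \<open>u < v\<close> have "m * m \<le> v * v" "m * m \<le> u * v" "m * m < u * u"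
        using mult_mono[of m "- v" m "- v"] mult_mono[of m "- u" m "- v"]
          mult_strict_mono[of m "- u" m "- u"] by auto
      then show ?thesis by (simp add: power2_eq_square)
    qed
    with \<open>u < v\<close> have "(v - u) * (v\<^sup>2 + u * v + u\<^sup>2 - 3 * m\<^sup>2) > 0"
      by simp
    then show ?thesis
      by (simp add: pm algebra_simps power2_eq_square power3_eq_cube)
  qed
  have "q \<ge> - 2 * m ^ 3"
  proof (rule ccontr)
    assume "\<not> q \<ge> - 2 * m ^ 3"
    \<comment> \<open>The left side is the cubic with \<open>q = - 2 * m ^ 3\<close>, which has a
      double root at \<open>- m\<close>. So \<open>x\<close> lies beyond \<open>2 * m\<close>, where
      the cubic increases and cannot drop in sign on the way to \<open>y\<close>.\<close>
    with fx have "(x + m)\<^sup>2 * (x - 2 * m) > 0"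
      by (simp add: pm algebra_simps power2_eq_square power3_eq_cube)
    then have "x > 2 * m" by (simp add: zero_less_mult_iff)
    with increasing[of x y] \<open>x < y\<close> m fx fy show False by simp
  qed
  moreover have "q \<le> 2 * m ^ 3"
  proof (rule ccontr)
    assume "\<not> q \<le> 2 * m ^ 3"
    with fy have "(y - m)\<^sup>2 * (y + 2 * m) < 0"
      by (simp add: pm algebra_simps power2_eq_square power3_eq_cube)
    then have "y < - 2 * m" by (simp add: mult_less_0_iff)
    with increasing[of x y] \<open>x < y\<close> m fx fy show False by simp
  qed
  ultimately have z: "- 1 \<le> - q / (2 * m ^ 3)" "- q / (2 * m ^ 3) \<le> 1"
    using m by (auto simp: field_simps)
  define \<theta> where "\<theta> = 1 / 3 * arccos (- q / (2 * m ^ 3))"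
  have s: "s = 2 * m * cos \<theta>"
    unfolding s_def arg \<theta>_def m_def ..
  have "cos (3 * \<theta>) = - q / (2 * m ^ 3)"
    using z by (simp add: \<theta>_def)
  then have "4 * cos \<theta> ^ 3 - 3 * cos \<theta> = - q / (2 * m ^ 3)"
    unfolding cos_treble_cos .
  then have "2 * m ^ 3 * (4 * cos \<theta> ^ 3 - 3 * cos \<theta>) = - q"
    using m by (simp add: eq_divide_eq mult.commute)
  then show "s ^ 3 + p * s + q = 0"
    by (simp add: s pm algebra_simps power2_eq_square power3_eq_cube)
  \<comment> \<open>As \<open>arccos\<close> is at most pi, \<theta> is even at most pi / 3.\<close>
  have "0 \<le> \<theta>" "\<theta> < pi / 2"
    using arccos_lbound[OF z] arccos_ubound[OF z] pi_gt_zero unfolding \<theta>_def by linarith+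
  then have "cos \<theta> > 0" by (intro cos_gt_zero_pi) auto
  with m show "s > 0" by (simp add: s)
qed

text \<open>
  The cubic is the characteristic polynomial of the Jacobi matrix with diagonal \<open>a, d, e\<close> and
  squared off-diagonal entries \<open>B = \<beta>\<gamma>\<close>, \<open>C = \<beta>(1 - \<gamma>)\<close>. It has opposite signs at the two
  eigenvalues of the leading \<open>2 \<times> 2\<close> block, which forces all its roots to be real.
\<close>

lemma jacobi_cubic_trig_root:
  fixes a d e \<beta> \<gamma> :: real
  assumes "\<beta> > 0" and "0 < \<gamma>" and "\<gamma> \<le> 1"
  defines "t1 \<equiv> a + d + e" and "t2 \<equiv> a * d + (a + d) * e - \<beta>"
    and "t3 \<equiv> a * d * e - a * \<beta> * (1 - \<gamma>) - e * \<beta> * \<gamma>"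
  defines "p \<equiv> t2 - t1\<^sup>2 / 3" and "q \<equiv> - (2 * t1 ^ 3 / 27) + t1 * t2 / 3 - t3"
  defines "\<mu> \<equiv> t1 / 3 + 2 * sqrt (- p / 3) *
                  cos (1 / 3 * arccos (3 * q / (2 * p) * sqrt (- 3 / p)))"
  shows "\<mu> ^ 3 - t1 * \<mu>\<^sup>2 + t2 * \<mu> - t3 = 0" and "\<mu> > t1 / 3"
proof -
  define B C where "B = \<beta> * \<gamma>" and "C = \<beta> * (1 - \<gamma>)"
  have B: "B > 0" and C: "C \<ge> 0"
    using assms(1-3) by (simp_all add: B_def C_def)
  have shift: "(z - t1 / 3) ^ 3 + p * (z - t1 / 3) + q = z ^ 3 - t1 * z\<^sup>2 + t2 * z - t3" for z
    by (simp add: p_def q_def field_simps power2_eq_square power3_eq_cube)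
  have "- 6 * p = (a - d)\<^sup>2 + (d - e)\<^sup>2 + (e - a)\<^sup>2 + 6 * \<beta>"
    by (simp add: p_def t1_def t2_def field_simps power2_eq_square)
  also have "\<dots> > 0"
    using assms(1,2) by (intro add_nonneg_pos) auto
  finally have p: "p < 0" by simp
  define r where "r = sqrt ((a - d)\<^sup>2 + 4 * B)"
  have r2: "r\<^sup>2 = (a - d)\<^sup>2 + 4 * B" using B by (simp add: r_def)
  have r: "r > \<bar>a - d\<bar>"
    unfolding r_def using B by (intro real_less_rsqrt) auto
  \<comment> \<open>These are the eigenvalues of the leading block. Since \<open>B > 0\<close>,
    \<open>a\<close> lies strictly between them. At each of them the leading minor vanishes, so the
    cubic reduces to \<open>C * (a - z)\<close>, whose sign is known.\<close>
  define x y where "x = (a + d - r) / 2" and "y = (a + d + r) / 2"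
  have "x < y" "x < a" "a < y"
    using r by (auto simp: x_def y_def field_simps)
  have fac: "z ^ 3 - t1 * z\<^sup>2 + t2 * z - t3 = ((z - a) * (z - d) - B) * (z - e) - C * (z - a)" for z
    by (simp add: t1_def t2_def t3_def B_def C_def algebra_simps power2_eq_square power3_eq_cube)
  have "(x - a) * (x - d) - B = 0" "(y - a) * (y - d) - B = 0"
    using r2 by (simp_all add: x_def y_def field_simps power2_eq_square)
  then have vals: "x ^ 3 - t1 * x\<^sup>2 + t2 * x - t3 = C * (a - x)"
      "y ^ 3 - t1 * y\<^sup>2 + t2 * y - t3 = C * (a - y)"
    unfolding fac by (simp_all add: algebra_simps)
  have "C * (a - x) \<ge> 0" "C * (a - y) \<le> 0"
    using C \<open>x < a\<close> \<open>a < y\<close> by (auto simp: mult_nonneg_nonpos)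
  then have "(x - t1 / 3) ^ 3 + p * (x - t1 / 3) + q \<ge> 0"
      "(y - t1 / 3) ^ 3 + p * (y - t1 / 3) + q \<le> 0"
    unfolding shift vals .
  from depressed_cubic_trig_root[OF p _ this] \<open>x < y\<close>
  have "(\<mu> - t1 / 3) ^ 3 + p * (\<mu> - t1 / 3) + q = 0" "\<mu> - t1 / 3 > 0"
    by (auto simp: \<mu>_def)
  then show "\<mu> ^ 3 - t1 * \<mu>\<^sup>2 + t2 * \<mu> - t3 = 0" "\<mu> > t1 / 3"
    unfolding shift by auto
qed

text \<open>Completing the square shows that the roots are real and bounded by the quadratic
  formula, so \<open>GREATEST\<close> really denotes a root. The lower bound later makes it
  positive.\<close>

lemma greatest_root_quadratic:
  fixes a d \<beta> :: real
  assumes "\<beta> \<ge> 0"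
  defines "\<mu> \<equiv> (GREATEST \<mu>. (\<mu> - a) * (\<mu> - d) - \<beta> = 0)"
  shows "(\<mu> - a) * (\<mu> - d) = \<beta>" and "\<mu> \<ge> (a + d) / 2"
proof -
  define r where "r = sqrt ((a - d)\<^sup>2 + 4 * \<beta>)"
  have r: "r \<ge> 0" "r\<^sup>2 = (a - d)\<^sup>2 + 4 * \<beta>" using assms(1) by (auto simp: r_def)
  have root: "((a + d + r) / 2 - a) * ((a + d + r) / 2 - d) - \<beta> = 0"
    using r(2) by (simp add: field_simps power2_eq_square)
  have \<mu>: "\<mu> = (a + d + r) / 2"
    unfolding \<mu>_def
  proof (rule Greatest_equality)
    show "((a + d + r) / 2 - a) * ((a + d + r) / 2 - d) - \<beta> = 0" by (fact root)
  next
    fix z assume "(z - a) * (z - d) - \<beta> = 0"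
    then have "(2 * z - (a + d))\<^sup>2 = r\<^sup>2"
      using r(2) by (simp add: algebra_simps power2_eq_square)
    then have "2 * z - (a + d) \<le> r"
      using r(1) by (simp add: power2_eq_iff) linarith
    then show "z \<le> (a + d + r) / 2" by simp
  qed
  show "(\<mu> - a) * (\<mu> - d) = \<beta>" using root unfolding \<mu> by simp
  show "\<mu> \<ge> (a + d) / 2" using r(1) unfolding \<mu> by simp
qed

section \<open>Orthogonal expansion in three dimensions and the gradient of a quadratic
  function\<close>

text \<open>Dimension three enters here: a nonzero residual would be a fourth vector orthogonal to
  the other three.\<close>

lemma orthogonal_triple_expansion:
  fixes u v w z :: "real ^ 3"
  assumes nz: "u \<noteq> 0" "v \<noteq> 0" "w \<noteq> 0" and orth: "u \<bullet> v = 0" "u \<bullet> w = 0" "v \<bullet> w = 0"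
  shows "z = (z \<bullet> u / (u \<bullet> u)) *\<^sub>R u + (z \<bullet> v / (v \<bullet> v)) *\<^sub>R v + (z \<bullet> w / (w \<bullet> w)) *\<^sub>R w"
proof (rule ccontr)
  define y where "y = z - ((z \<bullet> u / (u \<bullet> u)) *\<^sub>R u + (z \<bullet> v / (v \<bullet> v)) *\<^sub>R v + (z \<bullet> w / (w \<bullet> w)) *\<^sub>R w)"
  assume "\<not> ?thesis"
  then have y: "y \<noteq> 0" by (simp add: y_def)
  have yo: "y \<bullet> u = 0" "y \<bullet> v = 0" "y \<bullet> w = 0"
    using nz orth by (simp_all add: y_def inner_diff_left inner_add_left inner_commute[of v u]
        inner_commute[of w u] inner_commute[of w v])
  have "pairwise orthogonal {y, u, v, w}"
    using yo orth by (auto simp: pairwise_def orthogonal_def inner_commute)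
  then have "independent {y, u, v, w}"
    using nz y by (intro pairwise_orthogonal_independent) auto
  then have "card {y, u, v, w} \<le> 3"
    using independent_bound[of "{y, u, v, w}"] by simp
  moreover have "y \<noteq> u" "y \<noteq> v" "y \<noteq> w" "u \<noteq> v" "u \<noteq> w" "v \<noteq> w"
    using nz y yo orth by auto
  then have "card {y, u, v, w} = 4" by simp
  ultimately show False by simp
qed

text \<open>Symmetry merges the two terms of the product rule; uniqueness of the derivative resolves
  the definite description in \<open>gradient\<close>.\<close>

lemma gradient_quadratic:
  assumes "transpose H = H"
  shows "gradient (quadratic H b) x = H *v x + b"
proof -
  have sym: "x \<bullet> (H *v h) = h \<bullet> (H *v x)" for h
    by (metis assms dot_lmul_matrix inner_commute transpose_matrix_vector)
  have "((*v) H has_derivative (*v) H) (at x)"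
    by (intro bounded_linear_imp_has_derivative matrix_vector_mul_bounded_linear)
  then have "((\<lambda>x. 1 / 2 * (x \<bullet> (H *v x)) + b \<bullet> x) has_derivative
      (\<lambda>h. 1 / 2 * (x \<bullet> (H *v h) + h \<bullet> (H *v x)) + b \<bullet> h)) (at x)"
    by (intro has_derivative_add has_derivative_mult_right has_derivative_inner
        has_derivative_inner_right has_derivative_ident)
  moreover have "(\<lambda>h. 1 / 2 * (x \<bullet> (H *v h) + h \<bullet> (H *v x)) + b \<bullet> h) = (\<lambda>h. h \<bullet> (H *v x + b))"
    unfolding sym by (simp add: fun_eq_iff inner_add_right inner_commute)
  ultimately have D: "GDERIV (quadratic H b) x :> H *v x + b"
    unfolding gderiv_def quadratic_def by metis
  show ?thesis
    unfolding gradient_def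
  proof (rule the_equality)
    show "GDERIV (quadratic H b) x :> H *v x + b" by (fact D)
  next
    fix E assume "GDERIV (quadratic H b) x :> E"
    with D have "(\<lambda>h. h \<bullet> (H *v x + b)) = (\<lambda>h. h \<bullet> E)"
      unfolding gderiv_def by (rule has_derivative_unique)
    then show "E = H *v x + b"
      by (metis vector_eq_ldot)
  qed
qed

section \<open>Gradient steps with a symmetric positive definite matrix\<close>

locale spd_matrix =
  fixes H :: "real^'n^'n"
  assumes sym: "transpose H = H" and pos: "x \<noteq> 0 \<Longrightarrow> 0 < x \<bullet> (H *v x)"
begin

lemma inner_mult_right: "x \<bullet> (H *v y) = (H *v x) \<bullet> y"
  by (metis dot_lmul_matrix sym transpose_matrix_vector)

lemma mult_linear:
  "H *v (x + y) = H *v x + H *v y" "H *v (x - y) = H *v x - H *v y"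
  "H *v (c *\<^sub>R x) = c *\<^sub>R (H *v x)" "H *v (- x) = - (H *v x)" "H *v 0 = 0"
  using linear_add[OF matrix_vector_mul_linear] linear_diff[OF matrix_vector_mul_linear]
    linear_scale[OF matrix_vector_mul_linear] linear_neg[OF matrix_vector_mul_linear]
    linear_0[OF matrix_vector_mul_linear] by blast+

lemma sd_step_pos: "x \<noteq> 0 \<Longrightarrow> sd_step H x > 0"
  by (simp add: sd_step_def pos)

lemma orthogonal_sd_step: "x \<noteq> 0 \<Longrightarrow> x \<bullet> (x - sd_step H x *\<^sub>R (H *v x)) = 0"
  using pos[of x] by (simp add: sd_step_def inner_diff_right)

text \<open>A step applies \<open>I - \<alpha> H\<close>, which commutes with \<open>H\<close>, so a
  polynomial in \<open>H\<close> that annihilates \<open>x\<close> also annihilates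
  \<open>y\<close>, whatever the stepsize.\<close>

lemma quadratic_relation_step:
  assumes "H *v (H *v x) = u *\<^sub>R (H *v x) + v *\<^sub>R x" and "y = x - \<alpha> *\<^sub>R (H *v x)"
  shows "H *v (H *v y) = u *\<^sub>R (H *v y) + v *\<^sub>R y"
  unfolding assms(2) mult_linear assms(1) by (simp add: algebra_simps)

lemma eigenvector_step:
  assumes "H *v x = c *\<^sub>R x" and "y = x - \<alpha> *\<^sub>R (H *v x)"
  shows "H *v y = c *\<^sub>R y"
  unfolding assms(2) mult_linear assms(1) by (simp add: algebra_simps)

text \<open>The Rayleigh quotient of an eigenvector is its eigenvalue, so the Cauchy step is exactly
  \<open>1 / c\<close>.\<close>

lemma sd_step_eigenvector:
  assumes "H *v x = c *\<^sub>R x"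
  shows "x - sd_step H x *\<^sub>R (H *v x) = 0"
proof (cases "x = 0")
  case False
  with pos[OF False] have "c \<noteq> 0" by (auto simp: assms)
  with False show ?thesis by (simp add: sd_step_def assms)
qed (simp add: assms)

end

section \<open>The NY step after two Cauchy steps\<close>

locale two_sd_steps = spd_matrix +
  fixes g\<^sub>0 g\<^sub>1 g\<^sub>2 :: "real^'n"
  assumes g1: "g\<^sub>1 = g\<^sub>0 - sd_step H g\<^sub>0 *\<^sub>R (H *v g\<^sub>0)"
    and g2: "g\<^sub>2 = g\<^sub>1 - sd_step H g\<^sub>1 *\<^sub>R (H *v g\<^sub>1)"
    and nonzero: "g\<^sub>0 \<noteq> 0" "g\<^sub>1 \<noteq> 0" "g\<^sub>2 \<noteq> 0"
begin

text \<open>\<open>a\<close> and \<open>d\<close> are the Rayleigh quotients called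
  \<open>a11\<close> and \<open>a22\<close> in \<open>ny_step\<close>, the first two diagonal
  entries of the tridiagonal form of \<open>H\<close>.\<close>

definition "a = 1 / sd_step H g\<^sub>0"
definition "d = 1 / sd_step H g\<^sub>1"

lemma ad_pos: "a > 0" "d > 0"
  using nonzero by (simp_all add: a_def d_def sd_step_pos)

lemma H_g0: "H *v g\<^sub>0 = a *\<^sub>R (g\<^sub>0 - g\<^sub>1)"
  using sd_step_pos[OF nonzero(1)] by (simp add: g1 a_def)

lemma H_g1: "H *v g\<^sub>1 = d *\<^sub>R (g\<^sub>1 - g\<^sub>2)"
  using sd_step_pos[OF nonzero(2)] by (simp add: g2 d_def)

lemma orth: "g\<^sub>0 \<bullet> g\<^sub>1 = 0" "g\<^sub>1 \<bullet> g\<^sub>2 = 0"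
  using orthogonal_sd_step[OF nonzero(1)] orthogonal_sd_step[OF nonzero(2)]
  by (simp_all flip: g1 g2)

text \<open>This is symmetry of \<open>H\<close> tested on \<open>g\<^sub>0\<close> and
  \<open>g\<^sub>1\<close>. It ties together the off-diagonal entries and makes
  \<open>g\<^sub>0 \<bullet> g\<^sub>2\<close> positive.\<close>

lemma inner_g0_g2: "d * (g\<^sub>0 \<bullet> g\<^sub>2) = a * (g\<^sub>1 \<bullet> g\<^sub>1)"
  using inner_mult_right[of g\<^sub>0 g\<^sub>1] orth
  by (simp add: H_g0 H_g1 inner_diff_left inner_diff_right)

lemma inner_g0_g2_pos: "g\<^sub>0 \<bullet> g\<^sub>2 > 0"
  using inner_g0_g2 ad_pos nonzero(2)
  by (metis inner_gt_zero_iff mult_pos_pos zero_less_mult_pos)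

definition "\<beta> = (norm g\<^sub>2)\<^sup>2 / ((sd_step H g\<^sub>1)\<^sup>2 * (norm g\<^sub>1)\<^sup>2)"

lemma beta_eq: "\<beta> = d\<^sup>2 * (g\<^sub>2 \<bullet> g\<^sub>2) / (g\<^sub>1 \<bullet> g\<^sub>1)"
  by (simp add: \<beta>_def d_def power_divide power2_norm_eq_inner)

lemma beta_pos: "\<beta> > 0"
  using nonzero ad_pos by (simp add: beta_eq)

text \<open>The relation confines \<open>g\<^sub>2\<close> to the span of \<open>g\<^sub>0\<close>
  and \<open>g\<^sub>1\<close>; orthogonality to \<open>g\<^sub>1\<close> leaves only a multiple of
  \<open>g\<^sub>0\<close>.\<close>

lemma collinear_if_quadratic_relation:
  assumes "H *v (H *v g\<^sub>0) = u *\<^sub>R (H *v g\<^sub>0) + v *\<^sub>R g\<^sub>0"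
  shows "collinear {0, g\<^sub>0, g\<^sub>2}"
proof -
  have "(a * d) *\<^sub>R g\<^sub>2 = (u * a + v - a * a) *\<^sub>R g\<^sub>0 + (a * a + a * d - u * a) *\<^sub>R g\<^sub>1"
    using assms by (simp add: H_g0 H_g1 mult_linear algebra_simps)
  moreover from arg_cong[OF this, of "\<lambda>x. x \<bullet> g\<^sub>1"] have "a * a + a * d - u * a = 0"
    using orth nonzero by (simp add: inner_add_left) (simp add: inner_commute)
  ultimately have *: "(a * d) *\<^sub>R g\<^sub>2 = (u * a + v - a * a) *\<^sub>R g\<^sub>0" by simp
  have "g\<^sub>2 = ((u * a + v - a * a) / (a * d)) *\<^sub>R g\<^sub>0"
    using arg_cong[OF *, of "\<lambda>x. (1 / (a * d)) *\<^sub>R x"] ad_pos by simp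
  then show ?thesis by (auto simp: collinear_lemma)
qed

text \<open>The span of \<open>g\<^sub>0\<close> and \<open>g\<^sub>1\<close> is now invariant under
  \<open>H\<close>, and Yuan's quadratic is the characteristic polynomial there. Inverting a root of
  it removes one eigencomponent and leaves the other.\<close>

lemma ny_step_parallel:
  assumes col: "collinear {0, g\<^sub>0, g\<^sub>2}" and g3: "g\<^sub>3 = g\<^sub>2 - ny_step H g\<^sub>0 g\<^sub>1 g\<^sub>2 *\<^sub>R (H *v g\<^sub>2)"
  shows "\<exists>c. H *v g\<^sub>3 = c *\<^sub>R g\<^sub>3"
proof -
  obtain c where c: "g\<^sub>2 = c *\<^sub>R g\<^sub>0"
    using col nonzero by (auto simp: collinear_lemma)
  define \<mu> where "\<mu> = (GREATEST \<mu>. (\<mu> - a) * (\<mu> - d) - \<beta> = 0)"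
  have step: "ny_step H g\<^sub>0 g\<^sub>1 g\<^sub>2 = 1 / \<mu>"
    using col by (simp add: ny_step_def Let_def \<mu>_def a_def d_def \<beta>_def inverse_eq_divide)
  have root: "(\<mu> - a) * (\<mu> - d) = \<beta>" and lower: "\<mu> \<ge> (a + d) / 2"
    using greatest_root_quadratic[of \<beta> a d] beta_pos by (auto simp: \<mu>_def)
  have "\<mu> > 0" using lower ad_pos by simp
  have "g\<^sub>2 \<bullet> g\<^sub>2 = c * (g\<^sub>0 \<bullet> g\<^sub>2)" by (simp add: c)
  then have "\<beta> * (g\<^sub>1 \<bullet> g\<^sub>1) = d * c * (d * (g\<^sub>0 \<bullet> g\<^sub>2))"
    using nonzero(2) by (simp add: beta_eq power2_eq_square)
  then have beta: "\<beta> = a * d * c"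
    unfolding inner_g0_g2 using nonzero(2) by simp
  \<comment> \<open>This is \<open>\<mu> g\<^sub>0 - H g\<^sub>0\<close>. By the trace the other
    eigenvalue is \<open>a + d - \<mu>\<close>, and \<open>h\<close> satisfies its eigenvector
    equation by Cayley-Hamilton.\<close>
  define h where "h = (\<mu> - a) *\<^sub>R g\<^sub>0 + a *\<^sub>R g\<^sub>1"
  have "g\<^sub>3 = (c / \<mu>) *\<^sub>R h"
    unfolding g3 step unfolding c h_def mult_linear H_g0
    using \<open>\<mu> > 0\<close> by (simp add: vec_eq_iff field_simps)
  moreover have "H *v h = (a + d - \<mu>) *\<^sub>R h"
  proof -
    have Hg1: "H *v g\<^sub>1 = d *\<^sub>R g\<^sub>1 - (d * c) *\<^sub>R g\<^sub>0"
      by (simp add: H_g1 c algebra_simps)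
    have "H *v h = ((\<mu> - a) * a - \<beta>) *\<^sub>R g\<^sub>0 + (a * (a + d - \<mu>)) *\<^sub>R g\<^sub>1"
      unfolding h_def mult_linear H_g0 Hg1 beta by (simp add: algebra_simps)
    also have "(\<mu> - a) * a - \<beta> = (a + d - \<mu>) * (\<mu> - a)"
      by (simp add: algebra_simps flip: root)
    finally show ?thesis
      by (simp only: h_def scaleR_add_right scaleR_scaleR mult.commute[of a])
  qed
  ultimately have "H *v g\<^sub>3 = (a + d - \<mu>) *\<^sub>R g\<^sub>3"
    by (simp add: mult_linear)
  then show ?thesis ..
qed

end

text \<open>The NY cubic annihilates \<open>g\<^sub>2\<close> as a polynomial in \<open>H\<close>; a
  step by the inverse of a root divides out one linear factor. The expansion used for
  \<open>H *v w\<close> ties this case to dimension three.\<close>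

lemma ny_step_non_parallel:
  fixes H :: "real^3^3"
  assumes "two_sd_steps H g\<^sub>0 g\<^sub>1 g\<^sub>2"
    and ncol: "\<not> collinear {0, g\<^sub>0, g\<^sub>2}" and g3: "g\<^sub>3 = g\<^sub>2 - ny_step H g\<^sub>0 g\<^sub>1 g\<^sub>2 *\<^sub>R (H *v g\<^sub>2)"
  shows "\<exists>u v. H *v (H *v g\<^sub>3) = u *\<^sub>R (H *v g\<^sub>3) + v *\<^sub>R g\<^sub>3"
proof -
  interpret two_sd_steps H g\<^sub>0 g\<^sub>1 g\<^sub>2 by fact
  define x where "x = (g\<^sub>0 \<bullet> g\<^sub>2) / (g\<^sub>0 \<bullet> g\<^sub>0)"
  define w where "w = g\<^sub>2 - x *\<^sub>R g\<^sub>0"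
  have g2_eq: "g\<^sub>2 = x *\<^sub>R g\<^sub>0 + w" by (simp add: w_def)
  have w: "w \<noteq> 0"
    using ncol by (auto simp: w_def collinear_lemma)
  have w0: "g\<^sub>0 \<bullet> w = 0" and w1: "g\<^sub>1 \<bullet> w = 0"
    using nonzero(1) orth by (simp_all add: w_def x_def inner_diff_right inner_commute)
  have x: "x > 0" and dx: "d * x * (g\<^sub>0 \<bullet> g\<^sub>0) = a * (g\<^sub>1 \<bullet> g\<^sub>1)"
    using inner_g0_g2_pos inner_g0_g2 nonzero(1) by (simp_all add: x_def)
  define e where "e = w \<bullet> (H *v w) / (w \<bullet> w)"
  define k where "k = d * (w \<bullet> w) / (g\<^sub>1 \<bullet> g\<^sub>1)"
  have e: "e > 0" using w pos[OF w] by (simp add: e_def)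
  have H_g1': "H *v g\<^sub>1 = d *\<^sub>R g\<^sub>1 - (d * x) *\<^sub>R g\<^sub>0 - d *\<^sub>R w"
    by (simp add: H_g1 g2_eq algebra_simps)
  \<comment> \<open>Tridiagonality: \<open>H *v g\<^sub>0\<close> lies in the span of
    \<open>g\<^sub>0\<close> and \<open>g\<^sub>1\<close>, so by symmetry \<open>H *v w\<close> has
    no component along \<open>g\<^sub>0\<close>.\<close>
  have H_w: "H *v w = e *\<^sub>R w - k *\<^sub>R g\<^sub>1"
  proof -
    have "(H *v w) \<bullet> g\<^sub>0 = w \<bullet> (H *v g\<^sub>0)" "(H *v w) \<bullet> g\<^sub>1 = w \<bullet> (H *v g\<^sub>1)"
      by (simp_all add: inner_mult_right)
    moreover have "w \<bullet> (H *v g\<^sub>0) = 0"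
      using w0 w1 by (simp add: H_g0 inner_diff_right inner_commute)
    moreover have "w \<bullet> (H *v g\<^sub>1) = - (d * (w \<bullet> w))"
      using w0 w1 by (simp add: H_g1' inner_diff_right inner_commute)
    ultimately show ?thesis
      using orthogonal_triple_expansion[OF nonzero(1,2) w orth(1) w0 w1, of "H *v w"]
      by (simp add: e_def k_def inner_commute)
  qed
  define \<gamma> where "\<gamma> = (g\<^sub>2 \<bullet> g\<^sub>0)\<^sup>2 / ((norm g\<^sub>0)\<^sup>2 * (norm g\<^sub>2)\<^sup>2)"
  have g22: "g\<^sub>2 \<bullet> g\<^sub>2 = x\<^sup>2 * (g\<^sub>0 \<bullet> g\<^sub>0) + w \<bullet> w"
    using w0 by (simp add: g2_eq inner_add_left inner_add_right inner_commute power2_eq_square)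
  \<comment> \<open>\<gamma> is the squared cosine of the angle between \<open>g\<^sub>0\<close> and
    \<open>g\<^sub>2\<close>: the share of \<open>g\<^sub>2\<close> along \<open>g\<^sub>0\<close>,
    with \<open>1 - \<gamma>\<close> the share along \<open>w\<close>.\<close>
  have gam: "\<gamma> * (g\<^sub>2 \<bullet> g\<^sub>2) = x\<^sup>2 * (g\<^sub>0 \<bullet> g\<^sub>0)"
    using nonzero(1,3)
    unfolding \<gamma>_def x_def power2_norm_eq_inner inner_commute[of g\<^sub>2 g\<^sub>0]
    by (simp add: power2_eq_square)
  then have gam': "(1 - \<gamma>) * (g\<^sub>2 \<bullet> g\<^sub>2) = w \<bullet> w"
    by (simp add: g22 left_diff_distrib)
  have \<gamma>: "0 < \<gamma>" "\<gamma> < 1"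
    using gam gam' x w nonzero zero_less_mult_pos2[of \<gamma> "g\<^sub>2 \<bullet> g\<^sub>2"]
      zero_less_mult_pos2[of "1 - \<gamma>" "g\<^sub>2 \<bullet> g\<^sub>2"] by simp_all
  \<comment> \<open>So \<open>a33\<close> is the Rayleigh quotient of \<open>w\<close>: the cross
    terms in \<open>g\<^sub>2 \<bullet> (H *v g\<^sub>2)\<close> vanish.\<close>
  have e_eq: "(1 / sd_step H g\<^sub>2 - \<gamma> / sd_step H g\<^sub>0) / (1 - \<gamma>) = e"
  proof -
    have "g\<^sub>0 \<bullet> (H *v g\<^sub>0) = a * (g\<^sub>0 \<bullet> g\<^sub>0)"
      using orth by (simp add: H_g0 inner_diff_right)
    moreover have "g\<^sub>0 \<bullet> (H *v w) = 0"
      using w0 orth by (simp add: H_w inner_diff_right)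
    moreover have "w \<bullet> (H *v g\<^sub>0) = 0"
      using w0 w1 by (simp add: H_g0 inner_diff_right inner_commute)
    ultimately have "g\<^sub>2 \<bullet> (H *v g\<^sub>2) = x\<^sup>2 * (g\<^sub>0 \<bullet> g\<^sub>0) * a + e * (w \<bullet> w)"
      using w by (simp add: g2_eq mult_linear inner_add_left inner_add_right e_def power2_eq_square)
    also have "\<dots> = (\<gamma> * a + e * (1 - \<gamma>)) * (g\<^sub>2 \<bullet> g\<^sub>2)"
      unfolding gam[symmetric] gam'[symmetric] by (simp add: algebra_simps)
    finally have "1 / sd_step H g\<^sub>2 = \<gamma> * a + e * (1 - \<gamma>)"
      using nonzero(3) by (simp add: sd_step_def)
    then show ?thesis using \<gamma> by (simp add: a_def)
  qed
  \<comment> \<open>The products of opposite off-diagonal entries are \<open>a * d * x\<close> and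
    \<open>d * k\<close>. Matching them with \<beta>\<gamma> and \<beta>(1 - \<gamma>) identifies
    the NY cubic as the characteristic polynomial.\<close>
  have beta_gam: "\<beta> * \<gamma> = a * d * x"
  proof -
    have "\<beta> * \<gamma> * (g\<^sub>1 \<bullet> g\<^sub>1) = d\<^sup>2 * (\<gamma> * (g\<^sub>2 \<bullet> g\<^sub>2))"
      using nonzero(2) by (simp add: beta_eq)
    also have "\<dots> = d * x * (d * x * (g\<^sub>0 \<bullet> g\<^sub>0))"
      unfolding gam by (simp add: power2_eq_square)
    finally show ?thesis unfolding dx using nonzero(2) by simp
  qed
  have beta_gam': "\<beta> * (1 - \<gamma>) = d * k"
  proof -
    have "\<beta> * (1 - \<gamma>) * (g\<^sub>1 \<bullet> g\<^sub>1) = d\<^sup>2 * ((1 - \<gamma>) * (g\<^sub>2 \<bullet> g\<^sub>2))"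
      using nonzero(2) by (simp add: beta_eq)
    also have "\<dots> = d * k * (g\<^sub>1 \<bullet> g\<^sub>1)"
      unfolding gam' using nonzero(2) by (simp add: k_def power2_eq_square)
    finally show ?thesis using nonzero(2) by simp
  qed
  define t1 where "t1 = a + d + e"
  define t2 where "t2 = a * d + (a + d) * e - \<beta>"
  define t3 where "t3 = a * d * e - a * \<beta> * (1 - \<gamma>) - e * \<beta> * \<gamma>"
  define p where "p = t2 - t1\<^sup>2 / 3"
  define q where "q = - (2 * t1 ^ 3 / 27) + t1 * t2 / 3 - t3"
  define \<mu> where "\<mu> = t1 / 3 + 2 * sqrt (- p / 3) *
                  cos (1 / 3 * arccos (3 * q / (2 * p) * sqrt (- 3 / p)))"
  have step: "ny_step H g\<^sub>0 g\<^sub>1 g\<^sub>2 = inverse \<mu>"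
    unfolding ny_step_def Let_def if_not_P[OF ncol] \<beta>_def[symmetric] \<gamma>_def[symmetric] e_eq
      a_def[symmetric] d_def[symmetric] t1_def[symmetric] t2_def[symmetric] t3_def[symmetric]
      p_def[symmetric] q_def[symmetric] \<mu>_def[symmetric] ..
  have root: "t3 = \<mu> ^ 3 - t1 * \<mu>\<^sup>2 + t2 * \<mu>" and "\<mu> > t1 / 3"
    using jacobi_cubic_trig_root[OF beta_pos \<gamma>(1) less_imp_le[OF \<gamma>(2)], where a = a and d = d and e = e]
    unfolding t1_def[symmetric] t2_def[symmetric] t3_def[symmetric]
      p_def[symmetric] q_def[symmetric] \<mu>_def[symmetric] by auto
  then have \<mu>: "\<mu> > 0" using ad_pos e by (simp add: t1_def)
  have "\<beta> = a * d * x + d * k"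
    using beta_gam beta_gam' by (simp add: algebra_simps)
  then have t2: "t2 = a * d + (a + d) * e - a * d * x - d * k"
    by (simp add: t2_def)
  have t3: "t3 = a * d * e - a * d * k - e * a * d * x"
    using beta_gam beta_gam' by (simp add: t3_def mult.assoc)
  \<comment> \<open>\<open>P\<close> applies the characteristic polynomial of \<open>H\<close>. It
    commutes with gradient steps, so checking it at \<open>g\<^sub>0\<close> suffices.\<close>
  define P where "P z = H *v (H *v (H *v z)) - t1 *\<^sub>R (H *v (H *v z)) + t2 *\<^sub>R (H *v z) - t3 *\<^sub>R z" for z
  have P_step: "P (z - \<alpha> *\<^sub>R (H *v z)) = P z - \<alpha> *\<^sub>R (H *v P z)" for z \<alpha>
    by (simp add: P_def mult_linear algebra_simps)
  have "P g\<^sub>0 = 0"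
    unfolding P_def
    by (simp add: t1_def t2 t3 H_g0 H_g1' H_w mult_linear vec_eq_iff algebra_simps)
  then have "P g\<^sub>1 = 0" by (simp add: g1 P_step mult_linear)
  then have P2: "P g\<^sub>2 = 0" by (simp add: g2 P_step mult_linear)
  define h where "h = \<mu> *\<^sub>R g\<^sub>2 - H *v g\<^sub>2"
  have g3_eq: "g\<^sub>3 = (1 / \<mu>) *\<^sub>R h"
    using \<mu> by (simp add: g3 step h_def scaleR_diff_right inverse_eq_divide)
  have cube: "H *v (H *v (H *v g\<^sub>2)) = t1 *\<^sub>R (H *v (H *v g\<^sub>2)) - t2 *\<^sub>R (H *v g\<^sub>2) + t3 *\<^sub>R g\<^sub>2"
    using P2 by (simp add: P_def algebra_simps)
  \<comment> \<open>The coefficients come from dividing the cubic by its linear factor at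
    \<mu>.\<close>
  have "H *v (H *v h) = (t1 - \<mu>) *\<^sub>R (H *v h) + (t1 * \<mu> - \<mu>\<^sup>2 - t2) *\<^sub>R h"
    unfolding h_def mult_linear cube root
    by (simp add: vec_eq_iff algebra_simps power2_eq_square power3_eq_cube)
  then have "H *v (H *v g\<^sub>3) = (t1 - \<mu>) *\<^sub>R (H *v g\<^sub>3) + (t1 * \<mu> - \<mu>\<^sup>2 - t2) *\<^sub>R g\<^sub>3"
    by (simp add: g3_eq mult_linear scaleR_add_right mult.commute)
  then show ?thesis by blast
qed

section \<open>Counting iterations over two cycles\<close>

theorem theorem3p1:
  fixes H :: "real^3^3" and b x\<^sub>0 :: "real^3" and T :: nat
  assumes "transpose H = H"
    and "\<And>x. x \<noteq> 0 \<Longrightarrow> 0 < x \<bullet> (H *v x)"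
    and "T \<ge> 3"
  shows "\<exists>k \<le> 2 * T + 1. gradient (quadratic H b) (ny_iterate H b T x\<^sub>0 k) = 0"
proof (rule ccontr)
  interpret spd_matrix H
    using assms(1,2) by unfold_locales
  define g where "g k = gradient (quadratic H b) (ny_iterate H b T x\<^sub>0 k)" for k
  define \<alpha> where "\<alpha> k = ny_alpha H b T x\<^sub>0 k" for k
  assume "\<not> ?thesis"
  then have nz: "g k \<noteq> 0" if "k \<le> 2 * T + 1" for k
    using that by (auto simp: g_def)
  \<comment> \<open>The stopping branch is never taken under the contrary assumption, so the
    gradients follow the plain linear recursion.\<close>
  have g_Suc: "g (Suc k) = g k - \<alpha> k *\<^sub>R (H *v g k)" if "k \<le> 2 * T + 1" for k
  proof -
    have "ny_iterate H b T x\<^sub>0 (Suc k) = ny_iterate H b T x\<^sub>0 k - \<alpha> k *\<^sub>R g k"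
      using nz[OF that] by (simp add: Let_def g_def \<alpha>_def)
    then have "g (Suc k) = H *v (ny_iterate H b T x\<^sub>0 k - \<alpha> k *\<^sub>R g k) + b"
      by (simp add: g_def gradient_quadratic[OF assms(1)])
    also have "\<dots> = g k - \<alpha> k *\<^sub>R (H *v g k)"
      by (simp add: mult_linear g_def gradient_quadratic[OF assms(1)])
    finally show ?thesis .
  qed
  have sd: "\<alpha> k = sd_step H (g k)" if "k mod T < 2" for k
    using that by (simp add: \<alpha>_def g_def ny_alpha.simps)
  have mod_plus: "(k + i) mod T = i" if "k mod T = 0" "i < T" for k i
    using mod_add_left_eq[of k T i] that by simp
  have ny: "\<alpha> (k + 2) = ny_step H (g k) (g (k + 1)) (g (k + 2))" if "k mod T = 0" for k
  proof -
    have "(k + 2) mod T = 2" using mod_plus[of k 2] that assms(3) by simp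
    then show ?thesis by (simp add: \<alpha>_def g_def ny_alpha.simps)
  qed
  have two: "two_sd_steps H (g k) (g (k + 1)) (g (k + 2))" if "k mod T = 0" "k + 2 \<le> 2 * T + 1" for k
  proof -
    have "(k + 1) mod T = 1" using mod_plus[of k 1] that assms(3) by simp
    then show ?thesis
      using that nz g_Suc[of k] g_Suc[of "k + 1"] sd[of k] sd[of "k + 1"] by unfold_locales auto
  qed
  have cycle: "g (k + 3) = g (k + 2) - ny_step H (g k) (g (k + 1)) (g (k + 2)) *\<^sub>R (H *v g (k + 2))"
    if "k mod T = 0" "k + 2 \<le> 2 * T + 1" for k
    using g_Suc[of "k + 2"] ny that by (simp add: numeral_3_eq_3)
  have two0: "two_sd_steps H (g 0) (g 1) (g 2)"
    and cycle0: "g 3 = g 2 - ny_step H (g 0) (g 1) (g 2) *\<^sub>R (H *v g 2)"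
    using two[of 0] cycle[of 0] assms(3) by (simp_all add: numeral_2_eq_2)
  have "\<exists>u v. H *v (H *v g 3) = u *\<^sub>R (H *v g 3) + v *\<^sub>R g 3"
  proof (cases "collinear {0, g 0, g 2}")
    case True
    then obtain c where "H *v g 3 = c *\<^sub>R g 3"
      using two_sd_steps.ny_step_parallel[OF two0 _ cycle0] by blast
    \<comment> \<open>An eigenvector satisfies a quadratic relation with \<open>v = 0\<close>, so
      both cases continue alike.\<close>
    then have "H *v (H *v g 3) = c *\<^sub>R (H *v g 3) + 0 *\<^sub>R g 3"
      by (simp add: mult_linear)
    then show ?thesis by blast
  next
    case False
    then show ?thesis using ny_step_non_parallel[OF two0 _ cycle0] by blast
  qed
  then obtain u v where uv: "H *v (H *v g 3) = u *\<^sub>R (H *v g 3) + v *\<^sub>R g 3" by blast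
  \<comment> \<open>The relation is carried to the start of the second cycle; for
    \<open>T = 3\<close> it is already there.\<close>
  have "H *v (H *v g k) = u *\<^sub>R (H *v g k) + v *\<^sub>R g k" if "3 \<le> k" "k \<le> T" for k
    using that
  proof (induction k rule: dec_induct)
    case base
    show ?case by (fact uv)
  next
    case (step k)
    then have "H *v (H *v g k) = u *\<^sub>R (H *v g k) + v *\<^sub>R g k" "k \<le> 2 * T + 1" by simp_all
    then show ?case using quadratic_relation_step g_Suc by blast
  qed
  from this[of T] have "H *v (H *v g T) = u *\<^sub>R (H *v g T) + v *\<^sub>R g T"
    using assms(3) by simp
  moreover have twoT: "two_sd_steps H (g T) (g (T + 1)) (g (T + 2))"
    using assms(3) by (intro two) simp_all
  ultimately have "collinear {0, g T, g (T + 2)}"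
    by (intro two_sd_steps.collinear_if_quadratic_relation)
  moreover have "g (T + 3) = g (T + 2) - ny_step H (g T) (g (T + 1)) (g (T + 2)) *\<^sub>R (H *v g (T + 2))"
    using assms(3) by (intro cycle) simp_all
  ultimately obtain c where c: "H *v g (T + 3) = c *\<^sub>R g (T + 3)"
    using two_sd_steps.ny_step_parallel[OF twoT] by blast
  have "H *v g k = c *\<^sub>R g k" if "T + 3 \<le> k" "k \<le> 2 * T" for k
    using that
  proof (induction k rule: dec_induct)
    case base
    show ?case by (fact c)
  next
    case (step k)
    then have "H *v g k = c *\<^sub>R g k" "k \<le> 2 * T + 1" by simp_all
    then show ?case using eigenvector_step g_Suc by blast
  qed
  from this[of "2 * T"] have "H *v g (2 * T) = c *\<^sub>R g (2 * T)"
    using assms(3) by simp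
  \<comment> \<open>Index \<open>2 * T\<close> opens the third cycle, so its step is a Cauchy step,
    taken at an eigenvector.\<close>
  then have "g (2 * T + 1) = 0"
    using g_Suc[of "2 * T"] sd[of "2 * T"] sd_step_eigenvector by simp
  with nz show False by simp
qed

end
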